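(* Consider a system $x(t+1)=Ax(t)+Bu(t)$, $y(t)=Cx(t)$ with $x(t)\in\mathbb{R}^n$, $u(t)\in\mathbb{R}^m$, $y(t)\in\mathbb{R}^l$, controllable and observable, and let $\mathcal{T}\in\mathbb{R}^{n\times n}$ be invertible with $\mathcal{T}^{-1}A\mathcal{T}=\mathrm{diag}(\sigma_1,\dots,\sigma_n)$. Let $\Sigma=\{\sigma_1,\dots,\sigma_n\}$ denote the modes of the system and $M(t)=CA^{t-1}B\in\mathbb{R}^{l\times m}$ its impulse response. Let $T_0\ge n$. Then $M(T)$ (for any $T$) can be reconstructed from the modes $\Sigma$ and the samples $M(1:T_0+1)=\{M(1),\dots,M(T_0+1)\}$ by $$M(T)=\begin{bmatrix}I_l&\cdots&I_l\end{bmatrix}\,\mathcal{H}(\Sigma,T-1)\,H_{1:T_0}^{\dagger}\,\tilde M(2:T_0+1),$$ where $\mathcal{H}$, $H_{1:T_0}$ and $\tilde M(2:T_0+1)$ are defined in the context and $\begin{bmatrix}I_l&\cdots&I_l\end{bmatrix}$ contains $m$ copies of $I_l$.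
   Context: For $p=[p(1)\ \cdots\ p(n)]\in\mathbb{R}^{1\times n}$, $\mathcal{H}(p,t)\in\mathbb{R}^{lm\times lmn}$ is the block diagonal matrix with $lm$ diagonal blocks, each equal to the row vector $[p(1)^t\ \cdots\ p(n)^t]$; $\mathcal{H}(\Sigma,t)$ means $\mathcal{H}(p,t)$ with $p=[\sigma_1\ \cdots\ \sigma_n]$. $\tilde M(t)=\mathrm{blkdiag}(M_1(t),\dots,M_m(t))\in\mathbb{R}^{lm\times m}$, where $M_i(t)$ is the $i$-th column of $M(t)$. The stacked matrices are $$\tilde M(2:T_0+1)=\begin{bmatrix}\tilde M(2)\\ \vdots\\ \tilde M(T_0+1)\end{bmatrix},\qquad H_{1:T_0}=\begin{bmatrix}\mathcal{H}(\Sigma,1)\\ \vdots\\ \mathcal{H}(\Sigma,T_0)\end{bmatrix}.$$ $X^{\dagger}$ denotes the pseudoinverse.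
   Formalization: For T = 1 all modes are additionally assumed nonzero; with a zero mode the printed formula fails at T = 1 (e.g. l=m=n=T_0=1, A=0, B=C=1: M(1)=1 but the right-hand side is 0). For T ≥ 2 nothing is added. *)

theory Defs
  imports Complex_Main "Jordan_Normal_Form.Matrix"
begin

fun state_traj :: "real mat \<Rightarrow> real mat \<Rightarrow> (nat \<Rightarrow> real vec) \<Rightarrow> real vec \<Rightarrow> nat \<Rightarrow> real vec" where
  "state_traj A B u x0 0 = x0"
| "state_traj A B u x0 (Suc t) = A *\<^sub>v state_traj A B u x0 t + B *\<^sub>v u t"

definition output_traj ::
  "real mat \<Rightarrow> real mat \<Rightarrow> real mat \<Rightarrow> (nat \<Rightarrow> real vec) \<Rightarrow> real vec \<Rightarrow> nat \<Rightarrow> real vec" where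
  "output_traj A B C u x0 t = C *\<^sub>v state_traj A B u x0 t"

definition controllable :: "nat \<Rightarrow> nat \<Rightarrow> real mat \<Rightarrow> real mat \<Rightarrow> bool" where
  "controllable n m A B \<longleftrightarrow>
     (\<forall>x0 \<in> carrier_vec n. \<forall>xf \<in> carrier_vec n.
        \<exists>u N. (\<forall>t. u t \<in> carrier_vec m) \<and> state_traj A B u x0 N = xf)"

definition observable :: "nat \<Rightarrow> nat \<Rightarrow> real mat \<Rightarrow> real mat \<Rightarrow> real mat \<Rightarrow> bool" where
  "observable n m A B C \<longleftrightarrow>
     (\<forall>u. (\<forall>t. u t \<in> carrier_vec m) \<longrightarrow>
        (\<forall>x0 \<in> carrier_vec n. \<forall>x0' \<in> carrier_vec n.
           (\<forall>t. output_traj A B C u x0 t = output_traj A B C u x0' t) \<longrightarrow> x0 = x0'))"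

(* Meaningful for t >= 1 only: the subtraction on nat truncates at t = 0. *)
definition impulse_response :: "real mat \<Rightarrow> real mat \<Rightarrow> real mat \<Rightarrow> nat \<Rightarrow> real mat" where
  "impulse_response A B C t = C * A ^\<^sub>m (t - 1) * B"

(* The Moore-Penrose inverse: the unique solution of the four Penrose equations. *)
definition pseudoinverse :: "real mat \<Rightarrow> real mat" where
  "pseudoinverse X = (THE Y. Y \<in> carrier_mat (dim_col X) (dim_row X) \<and>
     X * Y * X = X \<and> Y * X * Y = Y \<and>
     transpose_mat (X * Y) = X * Y \<and> transpose_mat (Y * X) = Y * X)"

(* [F 0; ...; F (k-1)], each block of size r x c *)
definition block_col :: "nat \<Rightarrow> nat \<Rightarrow> nat \<Rightarrow> (nat \<Rightarrow> 'a mat) \<Rightarrow> 'a mat" where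
  "block_col r c k F = mat (k * r) c (\<lambda>(i, j). F (i div r) $$ (i mod r, j))"

(* [F 0, ..., F (k-1)], each block of size r x c *)
definition block_row :: "nat \<Rightarrow> nat \<Rightarrow> nat \<Rightarrow> (nat \<Rightarrow> 'a mat) \<Rightarrow> 'a mat" where
  "block_row r c k F = mat r (k * c) (\<lambda>(i, j). F (j div c) $$ (i, j mod c))"

(* The row vector p is a vec. Entry powers are natural-number powers, so 0 ^ 0 = 1. *)
definition modal_mat :: "nat \<Rightarrow> nat \<Rightarrow> real vec \<Rightarrow> nat \<Rightarrow> real mat" where
  "modal_mat l m p t =
     diag_block_mat (replicate (l * m) (mat 1 (dim_vec p) (\<lambda>(_, k). (p $ k) ^ t)))"

definition modal_stack :: "nat \<Rightarrow> nat \<Rightarrow> real vec \<Rightarrow> nat \<Rightarrow> real mat" where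
  "modal_stack l m p T0 =
     block_col (l * m) (l * m * dim_vec p) T0 (\<lambda>k. modal_mat l m p (k + 1))"

definition blkdiag_cols :: "real mat \<Rightarrow> real mat" where
  "blkdiag_cols M =
     diag_block_mat (map (\<lambda>i. mat_of_cols (dim_row M) [col M i]) [0 ..< dim_col M])"

(* The samples at times 2, ..., T0 + 1 only. *)
definition sample_stack :: "nat \<Rightarrow> nat \<Rightarrow> (nat \<Rightarrow> real mat) \<Rightarrow> nat \<Rightarrow> real mat" where
  "sample_stack l m M T0 = block_col (l * m) m T0 (\<lambda>k. blkdiag_cols (M (k + 2)))"

end

theory Submission
  imports Defs "HOL-Computational_Algebra.Polynomial"
begin

text \<open>In modal coordinates every entry of \<open>M(t+1)\<close> is a linear combination of the powers
  \<open>\<sigma>\<^sub>k ^ t\<close> with coefficients independent of \<open>t\<close>. Collecting these coefficients in \<open>X\<close> gives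
  \<open>blkdiag_cols (M (t + 1)) = modal_mat l m \<sigma> t * X\<close>, hence the sample stack is \<open>H * X\<close> with
  \<open>H\<close> the modal stack. As \<open>n\<close> rows of powers \<open>1, \<dots>, n\<close> already span every row of powers of the
  modes, \<open>modal_mat l m \<sigma> (T - 1) = W * H\<close> for some \<open>W\<close>, and the Penrose equation \<open>H * Y * H = H\<close>
  for the pseudoinverse \<open>Y\<close> turns \<open>W * H * Y * (H * X)\<close> into \<open>W * H * X\<close>, even if repeated or
  zero modes make \<open>H\<close> rank deficient.\<close>

subsection \<open>Block matrices\<close>

text \<open>Splits the inner index of a matrix product as \<open>q = a * c + b\<close>, block number
  and offset.\<close>

lemma sum_mult_div_mod:
  fixes f :: "nat \<Rightarrow> nat \<Rightarrow> 'a::comm_monoid_add"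
  shows "(\<Sum>q = 0..<k * c. f (q div c) (q mod c)) = (\<Sum>a = 0..<k. \<Sum>b = 0..<c. f a b)"
proof -
  have "(\<Sum>b = 0..<c. f a b) = (\<Sum>q = a * c..<a * c + c. f (q div c) (q mod c))" for a
  proof -
    have "(\<Sum>q = a * c..<a * c + c. f (q div c) (q mod c))
        = (\<Sum>b = 0..<c. f ((b + a * c) div c) ((b + a * c) mod c))"
      using sum.shift_bounds_nat_ivl[of "\<lambda>q. f (q div c) (q mod c)" 0 "a * c" c]
      by (simp add: add.commute)
    then show ?thesis
      by simp
  qed
  then show ?thesis
    using sum.nat_group[of "\<lambda>q. f (q div c) (q mod c)" c k] by (simp add: lessThan_atLeast0)
qed

lemma block_index_less:
  fixes q k c :: nat
  assumes "q < k * c"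
  shows "q div c < k" "q mod c < c" "0 < c"
  using assms by (auto simp: less_mult_imp_div_less intro!: mod_less_divisor gr0I)

lemma index_mult_mat_sum:
  assumes "A \<in> carrier_mat a b" "B \<in> carrier_mat b c" "i < a" "j < c"
  shows "(A * B) $$ (i, j) = (\<Sum>q = 0..<b. A $$ (i, q) * B $$ (q, j))"
  using assms by (auto simp: scalar_prod_def)

lemma block_col_carrier: "block_col r c k F \<in> carrier_mat (k * r) c"
  by (simp add: block_col_def)

lemma block_row_carrier: "block_row r c k F \<in> carrier_mat r (k * c)"
  by (simp add: block_row_def)

lemma block_col_mult:
  assumes F: "\<And>t. t < k \<Longrightarrow> F t \<in> carrier_mat r c" and X: "X \<in> carrier_mat c d"
  shows "block_col r c k F * X = block_col r d k (\<lambda>t. F t * X)"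
proof (rule eq_matI)
  fix i j
  assume "i < dim_row (block_col r d k (\<lambda>t. F t * X))" "j < dim_col (block_col r d k (\<lambda>t. F t * X))"
  then have i: "i < k * r" and j: "j < d"
    by (auto simp: block_col_def)
  note b = block_index_less[OF i]
  show "(block_col r c k F * X) $$ (i, j) = block_col r d k (\<lambda>t. F t * X) $$ (i, j)"
    using i j b
    by (simp only: index_mult_mat_sum[OF block_col_carrier X i j])
      (simp add: index_mult_mat_sum[OF F X] block_col_def del: index_mult_mat)
qed (use X in \<open>auto simp: block_col_def\<close>)

lemma index_block_row_mult_block_col:
  assumes F: "\<And>t. t < k \<Longrightarrow> F t \<in> carrier_mat r c" and G: "\<And>t. t < k \<Longrightarrow> G t \<in> carrier_mat c d"
    and i: "i < r" and j: "j < d"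
  shows "(block_row r c k F * block_col c d k G) $$ (i, j) = (\<Sum>t = 0..<k. (F t * G t) $$ (i, j))"
proof -
  have "(block_row r c k F * block_col c d k G) $$ (i, j)
      = (\<Sum>q = 0..<k * c. F (q div c) $$ (i, q mod c) * G (q div c) $$ (q mod c, j))"
    using i j
    by (simp only: index_mult_mat_sum[OF block_row_carrier block_col_carrier i j])
      (simp add: block_row_def block_col_def)
  also have "\<dots> = (\<Sum>t = 0..<k. \<Sum>b = 0..<c. F t $$ (i, b) * G t $$ (b, j))"
    by (rule sum_mult_div_mod)
  also have "\<dots> = (\<Sum>t = 0..<k. (F t * G t) $$ (i, j))"
    by (intro sum.cong) (simp_all add: index_mult_mat_sum[OF F G i j])
  finally show ?thesis .
qed

text \<open>Induction peels off the first block: indices beyond it shift by one block size, so their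
  quotient drops by one and their remainder is kept.\<close>

lemma diag_block_mat_uniform:
  assumes "0 < r" "0 < c" "\<And>M. M \<in> set Ms \<Longrightarrow> M \<in> carrier_mat r c"
  shows "diag_block_mat Ms = mat (length Ms * r) (length Ms * c)
    (\<lambda>(i, j). if i div r = j div c then (Ms ! (i div r)) $$ (i mod r, j mod c) else 0)"
  using assms(3)
proof (induction Ms)
  case (Cons M Ms)
  have M: "M \<in> carrier_mat r c"
    using Cons.prems by simp
  have IH: "diag_block_mat Ms = mat (length Ms * r) (length Ms * c)
    (\<lambda>(i, j). if i div r = j div c then (Ms ! (i div r)) $$ (i mod r, j mod c) else 0)"
    using Cons by simp
  show ?case
  proof (rule eq_matI, goal_cases)
    case (1 i j)
    then have ij: "i < r + length Ms * r" "j < c + length Ms * c"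
      by auto
    have div: "i div r = Suc ((i - r) div r) \<and> i mod r = (i - r) mod r" if "0 < r" "r \<le> i" for i r :: nat
      using that by (simp add: le_div_geq le_mod_geq)
    show ?case
      using ij M assms(1,2) div[of r i] div[of c j]
      by (cases "i < r"; cases "j < c")
        (auto simp: Let_def IH)
  qed (use M in \<open>auto simp: Let_def IH\<close>)
qed (auto intro!: eq_matI)

lemma modal_mat_eq:
  assumes p: "p \<in> carrier_vec n" and n: "0 < n"
  shows "modal_mat l m p t = mat (l * m) (l * m * n) (\<lambda>(i, j). if i = j div n then (p $ (j mod n)) ^ t else 0)"
  unfolding modal_mat_def using p n
  by (subst diag_block_mat_uniform[of 1 n]) (auto intro!: eq_matI dest: block_index_less)

lemma modal_stack_carrier:
  "p \<in> carrier_vec n \<Longrightarrow> modal_stack l m p T0 \<in> carrier_mat (T0 * (l * m)) (l * m * n)"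
  using block_col_carrier by (auto simp: modal_stack_def)

lemma blkdiag_cols_eq:
  assumes M: "M \<in> carrier_mat l m" and l: "0 < l"
  shows "blkdiag_cols M = mat (l * m) m (\<lambda>(i, j). if i div l = j then M $$ (i mod l, j) else 0)"
  unfolding blkdiag_cols_def using M l
  by (subst diag_block_mat_uniform[of l 1])
    (auto intro!: eq_matI simp: mat_of_cols_index mult.commute dest: block_index_less)

text \<open>Cut into \<open>m\<close> slices of height \<open>l\<close>,
  \<open>blkdiag_cols M\<close> has as slice \<open>t\<close> the matrix \<open>M\<close> with all
  columns but the \<open>t\<close>-th erased. The row of identities adds the slices up
  again.\<close>

lemma sum_blkdiag_cols:
  assumes M: "M \<in> carrier_mat l m" and l: "0 < l"
  shows "block_row l l m (\<lambda>_. 1\<^sub>m l) * blkdiag_cols M = M"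
proof -
  define G where "G t = mat l m (\<lambda>(i, j). if t = j then M $$ (i, j) else 0)" for t
  have G: "G t \<in> carrier_mat l m" for t
    by (simp add: G_def)
  have eq: "blkdiag_cols M = block_col l m m G"
    by (auto intro!: eq_matI simp: blkdiag_cols_eq[OF M l] block_col_def G_def mult.commute[of m]
        l)
  show ?thesis
    unfolding eq
  proof (rule eq_matI)
    fix i j assume "i < dim_row M" "j < dim_col M"
    then have ij: "i < l" "j < m"
      using M by auto
    have "(block_row l l m (\<lambda>_. 1\<^sub>m l) * block_col l m m G) $$ (i, j)
        = (\<Sum>t = 0..<m. (1\<^sub>m l * G t) $$ (i, j))"
      by (rule index_block_row_mult_block_col) (use ij G in auto)
    also have "\<dots> = (\<Sum>t = 0..<m. if t = j then M $$ (i, j) else 0)"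
      using ij by (simp add: left_mult_one_mat[OF G]) (simp add: G_def)
    also have "\<dots> = M $$ (i, j)"
      using ij by simp
    finally show "(block_row l l m (\<lambda>_. 1\<^sub>m l) * block_col l m m G) $$ (i, j) = M $$ (i, j)" .
  qed (use M in \<open>auto simp: block_row_def block_col_def\<close>)
qed

subsection \<open>Existence and uniqueness of the pseudoinverse\<close>

text \<open>One Gram-Schmidt step per column, without any rank assumption. The target
  \<open>v\<close> is generalized because the induction hypothesis is applied both to
  \<open>v\<close> and to the new column.\<close>

lemma least_squares_exists:
  fixes X :: "nat \<Rightarrow> nat \<Rightarrow> real"
  shows "\<exists>g. \<forall>i<c. (\<Sum>a = 0..<r. X a i * (v a - (\<Sum>j = 0..<c. X a j * g j))) = 0"
proof (induction c arbitrary: v)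
  case (Suc c)
  define ip where "ip f h = (\<Sum>a = 0..<r. f a * h a)" for f h :: "nat \<Rightarrow> real"
  define comb where "comb g a = (\<Sum>j = 0..<c. X a j * g j)" for g a
  have ip_diff: "ip f (\<lambda>a. h a - t * h' a) = ip f h - t * ip f h'" for f h h' t
    by (simp add: ip_def algebra_simps sum_subtractf sum_distrib_left)
  have ip_comb: "ip f (comb g) = 0" if "\<forall>i<c. ip (\<lambda>a. X a i) f = 0" for f g
  proof -
    have "ip f (comb g) = (\<Sum>j = 0..<c. g j * ip (\<lambda>a. X a j) f)"
      unfolding ip_def comb_def
      by (simp add: sum_distrib_left) (subst sum.swap, simp add: algebra_simps)
    then show ?thesis
      using that by simp
  qed
  obtain g where g: "\<forall>i<c. ip (\<lambda>a. X a i) (\<lambda>a. v a - comb g a) = 0"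
    using Suc[of v] unfolding ip_def comb_def by blast
  obtain h where h: "\<forall>i<c. ip (\<lambda>a. X a i) (\<lambda>a. X a c - comb h a) = 0"
    using Suc[of "\<lambda>a. X a c"] unfolding ip_def comb_def by blast
  define z where "z a = v a - comb g a" for a
  define w where "w a = X a c - comb h a" for a
  \<comment> \<open>Projection coefficient of the residual \<open>z\<close> on \<open>w\<close>, the
    part of the new column orthogonal to the earlier ones.\<close>
  define t where "t = ip (\<lambda>a. X a c) z / ip w w"
  have z: "\<forall>i<c. ip (\<lambda>a. X a i) z = 0" and w: "\<forall>i<c. ip (\<lambda>a. X a i) w = 0"
    using g h by (auto simp: z_def[abs_def] w_def[abs_def])
  have comm: "ip f f' = ip f' f" for f f'
    by (simp add: ip_def mult.commute)
  have ip_w: "ip f w = ip f (\<lambda>a. X a c)" if "\<forall>i<c. ip (\<lambda>a. X a i) f = 0" for f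
    using ip_diff[of f "\<lambda>a. X a c" 1 "comb h"] ip_comb[OF that] by (simp add: w_def[abs_def])
  have ww: "ip (\<lambda>a. X a c) w = ip w w" and zw: "ip (\<lambda>a. X a c) z = ip w z"
    using ip_w[OF w] ip_w[OF z] comm by metis+
  \<comment> \<open>If \<open>ip w w = 0\<close>, then \<open>t = 0\<close> because the division yields \<open>0\<close>;
    here \<open>w\<close> vanishes, so no correction is needed.\<close>
  have new: "ip (\<lambda>a. X a c) (\<lambda>a. z a - t * w a) = 0"
  proof (cases "ip w w = 0")
    case True
    then have "w a = 0" if "a < r" for a
      using that by (simp add: ip_def sum_nonneg_eq_0_iff)
    then have "ip w z = 0"
      by (simp add: ip_def)
    then show ?thesis
      using True by (simp add: ip_diff zw ww)
  next
    case False
    then have "t * ip w w = ip (\<lambda>a. X a c) z"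
      by (simp add: t_def)
    then show ?thesis
      by (simp only: ip_diff ww diff_self)
  qed
  have old: "\<forall>i<c. ip (\<lambda>a. X a i) (\<lambda>a. z a - t * w a) = 0"
    using z w by (simp add: ip_diff)
  have all: "ip (\<lambda>a. X a i) (\<lambda>a. z a - t * w a) = 0" if "i < Suc c" for i
    using old new that less_Suc_eq by auto
  \<comment> \<open>Read off from \<open>z - t * w\<close>: the new column enters with weight
    \<open>t\<close>, and \<open>comb h\<close> inside \<open>w\<close> changes the earlier
    weights.\<close>
  define g' where "g' j = (if j = c then t else g j - t * h j)" for j
  have "z a - t * w a = v a - (\<Sum>j = 0..<Suc c. X a j * g' j)" for a
    by (simp add: g'_def z_def w_def comb_def algebra_simps sum_subtractf sum_distrib_left)
  then show ?case
    using all unfolding ip_def by (intro exI[of _ g']) auto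
qed simp

text \<open>Column \<open>b\<close> of \<open>G\<close> is a least-squares solution for the
  \<open>b\<close>-th unit vector.\<close>

lemma normal_equation_solvable:
  fixes X :: "real mat"
  assumes X: "X \<in> carrier_mat r c"
  shows "\<exists>G \<in> carrier_mat c r. X\<^sup>T * (X * G) = X\<^sup>T"
proof -
  have "\<forall>b. \<exists>g. \<forall>i<c. (\<Sum>a = 0..<r. X $$ (a, i) *
      ((if a = b then 1 else 0) - (\<Sum>j = 0..<c. X $$ (a, j) * g j))) = 0"
    by (intro allI least_squares_exists)
  from choice[OF this] obtain g where g: "\<forall>b. \<forall>i<c. (\<Sum>a = 0..<r. X $$ (a, i) *
      ((if a = b then 1 else 0) - (\<Sum>j = 0..<c. X $$ (a, j) * g b j))) = 0"
    by blast
  define G where "G = mat c r (\<lambda>(j, b). g b j)"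
  have G: "G \<in> carrier_mat c r"
    by (simp add: G_def)
  have "X\<^sup>T * (X * G) = X\<^sup>T"
  proof (rule eq_matI)
    fix i b assume "i < dim_row X\<^sup>T" "b < dim_col X\<^sup>T"
    then have ib: "i < c" "b < r"
      using X by auto
    have Xt: "X\<^sup>T \<in> carrier_mat c r" and XG: "X * G \<in> carrier_mat r r"
      using X G by auto
    have XG_entry: "(X * G) $$ (a, b) = (\<Sum>j = 0..<c. X $$ (a, j) * g b j)" if "a < r" for a
      using ib by (simp only: index_mult_mat_sum[OF X G that]) (simp add: G_def)
    have "(X\<^sup>T * (X * G)) $$ (i, b)
        = (\<Sum>a = 0..<r. X $$ (a, i) * (\<Sum>j = 0..<c. X $$ (a, j) * g b j))"
      using ib X by (simp only: index_mult_mat_sum[OF Xt XG])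
        (intro sum.cong refl, simp add: XG_entry del: index_mult_mat)
    also have "\<dots> = (\<Sum>a = 0..<r. X $$ (a, i) * (if a = b then 1 else 0))"
      using g ib by (simp add: right_diff_distrib sum_subtractf)
    also have "\<dots> = X $$ (b, i)"
      using ib by (simp add: if_distrib cong: if_cong)
    finally show "(X\<^sup>T * (X * G)) $$ (i, b) = X\<^sup>T $$ (i, b)"
      using ib X by simp
  qed (use X G in auto)
  then show ?thesis
    using G by blast
qed

text \<open>The predicate under the description operator in \<open>pseudoinverse\<close>, named so
  that existence and uniqueness can be proved separately.\<close>

definition is_pseudoinverse :: "real mat \<Rightarrow> real mat \<Rightarrow> bool" where
  "is_pseudoinverse X Y \<longleftrightarrow> Y \<in> carrier_mat (dim_col X) (dim_row X) \<and>
     X * Y * X = X \<and> Y * X * Y = Y \<and>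
     transpose_mat (X * Y) = X * Y \<and> transpose_mat (Y * X) = Y * X"

text \<open>Transposing the equation and multiplying by \<open>G\<close> shows that
  \<open>X * G\<close> equals its own Gram matrix, which is symmetric. Thus \<open>X * G\<close> is
  the orthogonal projector onto the column space of \<open>X\<close>.\<close>

lemma normal_equation_inverse:
  fixes X :: "real mat"
  assumes X: "X \<in> carrier_mat r c" and G: "G \<in> carrier_mat c r" and eq: "X\<^sup>T * (X * G) = X\<^sup>T"
  shows "(X * G)\<^sup>T = X * G" "X * G * X = X"
proof -
  have XG: "X * G \<in> carrier_mat r r" and Xt: "X\<^sup>T \<in> carrier_mat c r"
    using X G by auto
  have "(X * G)\<^sup>T * X = X"
    using arg_cong[OF eq, of transpose_mat] transpose_mult[OF Xt XG] by simp
  then have *: "(X * G)\<^sup>T * (X * G) = X * G"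
    using assoc_mult_mat[OF _ X G, of "(X * G)\<^sup>T" r] XG by simp
  moreover have "((X * G)\<^sup>T * (X * G))\<^sup>T = (X * G)\<^sup>T * (X * G)"
    using transpose_mult[of "(X * G)\<^sup>T" r r "X * G" r] XG by simp
  ultimately show sym: "(X * G)\<^sup>T = X * G"
    by simp
  show "X * G * X = X"
    using \<open>(X * G)\<^sup>T * X = X\<close> sym by simp
qed

text \<open>Normal equations for \<open>X\<close> and for its transpose give a {1,3}-inverse \<open>G\<close> and a
  {1,4}-inverse \<open>F\<close>; Urquhart's product \<open>F * X * G\<close> then satisfies all four Penrose equations.\<close>

lemma pseudoinverse_exists: "\<exists>Y. is_pseudoinverse X Y"
proof -
  define r c where "r = dim_row X" and "c = dim_col X"
  have X: "X \<in> carrier_mat r c" and Xt: "X\<^sup>T \<in> carrier_mat c r"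
    by (auto simp: r_def c_def)
  obtain G where G: "G \<in> carrier_mat c r" and G_eq: "X\<^sup>T * (X * G) = X\<^sup>T"
    using normal_equation_solvable[OF X] by blast
  obtain E where E: "E \<in> carrier_mat r c" and E_eq: "X\<^sup>T\<^sup>T * (X\<^sup>T * E) = X\<^sup>T\<^sup>T"
    using normal_equation_solvable[OF Xt] by blast
  note G13 = normal_equation_inverse[OF X G G_eq]
  note E13 = normal_equation_inverse[OF Xt E E_eq]
  define F where "F = E\<^sup>T"
  have F: "F \<in> carrier_mat c r"
    using E by (simp add: F_def)
  have FX: "F * X = X\<^sup>T * E"
    using E13(1) transpose_mult[OF Xt E] by (simp add: F_def)
  have FX_sym: "(F * X)\<^sup>T = F * X"
    using E13(1) FX by simp
  have XFX: "X * (F * X) = X"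
  proof -
    have "(X\<^sup>T * E * X\<^sup>T)\<^sup>T = X * (X\<^sup>T * E)\<^sup>T"
      using transpose_mult[of "X\<^sup>T * E" c c "X\<^sup>T" r] Xt E by simp
    then show ?thesis
      using E13 FX by simp
  qed
  define Y where "Y = F * X * G"
  have FXc: "F * X \<in> carrier_mat c c"
    using F X by simp
  have XY: "X * Y = X * G"
    unfolding Y_def using assoc_mult_mat[OF X FXc G] XFX by simp
  have YX: "Y * X = F * X"
  proof -
    have GX: "G * X \<in> carrier_mat c c"
      using G X by simp
    have "Y * X = F * (X * (G * X))"
      unfolding Y_def by (simp only: assoc_mult_mat[OF FXc G X] assoc_mult_mat[OF F X GX])
    then show ?thesis
      by (simp only: assoc_mult_mat[OF X G X, symmetric] G13(2))
  qed
  have "Y * X * Y = Y"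
  proof -
    have "Y * X * Y = F * X * (F * X * G)"
      by (simp add: YX) (simp add: Y_def)
    also have "\<dots> = F * X * (F * X) * G"
      by (rule assoc_mult_mat[OF FXc FXc G, symmetric])
    also have "F * X * (F * X) = F * (X * (F * X))"
      by (rule assoc_mult_mat[OF F X FXc])
    finally show ?thesis
      by (simp add: XFX Y_def)
  qed
  moreover have "Y \<in> carrier_mat c r"
    unfolding Y_def using FXc G by (rule mult_carrier_mat)
  ultimately have "is_pseudoinverse X Y"
    using G13 FX_sym unfolding is_pseudoinverse_def XY YX r_def c_def by blast
  then show ?thesis ..
qed

text \<open>\<open>X * Y\<close> and \<open>X * Z\<close> project orthogonally onto the same column
  space, so they agree: each absorbs the other, and transposition swaps the factors. Likewise
  \<open>Y * X = Z * X\<close>, whence \<open>Y = Y * X * Y = Z * X * Z = Z\<close>.\<close>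

lemma pseudoinverse_unique:
  assumes "is_pseudoinverse X Y" "is_pseudoinverse X Z"
  shows "Y = Z"
proof -
  define r c where "r = dim_row X" and "c = dim_col X"
  have X: "X \<in> carrier_mat r c"
    by (auto simp: r_def c_def)
  have Y: "Y \<in> carrier_mat c r" and Z: "Z \<in> carrier_mat c r"
    and Y1: "X * Y * X = X" "Y * X * Y = Y" "(X * Y)\<^sup>T = X * Y" "(Y * X)\<^sup>T = Y * X"
    and Z1: "X * Z * X = X" "Z * X * Z = Z" "(X * Z)\<^sup>T = X * Z" "(Z * X)\<^sup>T = Z * X"
    using assms by (auto simp: is_pseudoinverse_def r_def c_def)
  have XYc: "X * Y \<in> carrier_mat r r" and XZc: "X * Z \<in> carrier_mat r r"
    and YXc: "Y * X \<in> carrier_mat c c" and ZXc: "Z * X \<in> carrier_mat c c"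
    using X Y Z by auto
  have "X * Y = (X * Z) * (X * Y)"
    using assoc_mult_mat[OF XZc X Y] Z1(1) by simp
  also have "\<dots> = (X * Y * (X * Z))\<^sup>T"
    using transpose_mult[OF XYc XZc] Y1(3) Z1(3) by simp
  also have "\<dots> = X * Z"
    using assoc_mult_mat[OF XYc X Z] Y1(1) Z1(3) by simp
  finally have XY: "X * Y = X * Z" .
  have "Y * X = Y * X * (Z * X)"
    using assoc_mult_mat[OF Y X ZXc] assoc_mult_mat[OF X Z X] Z1(1) by simp
  also have "\<dots> = (Z * X * (Y * X))\<^sup>T"
    using transpose_mult[OF ZXc YXc] Y1(4) Z1(4) by simp
  also have "\<dots> = Z * X"
    using assoc_mult_mat[OF Z X YXc] assoc_mult_mat[OF X Y X] Y1(1) Z1(4) by simp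
  finally have YX: "Y * X = Z * X" .
  have "Y = Z * X * Y"
    using Y1(2) YX by simp
  also have "\<dots> = Z * X * Z"
    using assoc_mult_mat[OF Z X Y] assoc_mult_mat[OF Z X Z] XY by simp
  finally show ?thesis
    using Z1(2) by simp
qed

lemma is_pseudoinverse_pseudoinverse: "is_pseudoinverse X (pseudoinverse X)"
proof -
  have "\<exists>!Y. is_pseudoinverse X Y"
    using pseudoinverse_exists pseudoinverse_unique by blast
  then show ?thesis
    unfolding pseudoinverse_def is_pseudoinverse_def by (rule theI')
qed

subsection \<open>Powers of the modes\<close>

lemma poly_as_sum_below:
  fixes p :: "'a::comm_semiring_1 poly"
  assumes "degree p < N"
  shows "poly p x = (\<Sum>t = 0..<N. Polynomial.coeff p t * x ^ t)"
proof -
  have "(\<Sum>t = 0..<N. Polynomial.coeff p t * x ^ t) = (\<Sum>t\<le>degree p. Polynomial.coeff p t * x ^ t)"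
    using assms by (intro sum.mono_neutral_right) (auto simp: coeff_eq_0)
  then show ?thesis
    by (simp add: poly_altdef)
qed

text \<open>With \<open>q\<close> the monic polynomial vanishing at all modes, take \<open>p\<close> as the remainder of
  \<open>x ^ (s - 1)\<close> modulo \<open>q\<close> when \<open>s > 0\<close>; when \<open>s = 0\<close>, \<open>q = q(0) + x r\<close>
  shows that \<open>- r / q(0)\<close> takes the value \<open>1 / x\<close> at every mode.\<close>

lemma power_interpolation:
  fixes \<sigma> :: "nat \<Rightarrow> real"
  assumes n: "0 < n" and nz: "s = 0 \<Longrightarrow> \<forall>k<n. \<sigma> k \<noteq> 0"
  obtains p where "degree p < n" "\<And>k. k < n \<Longrightarrow> \<sigma> k * poly p (\<sigma> k) = \<sigma> k ^ s"
proof -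
  define q where "q = (\<Prod>k = 0..<n. [:- \<sigma> k, 1:])"
  have deg_q: "degree q = n"
    by (simp add: q_def degree_prod_eq_sum_degree)
  have root: "poly q (\<sigma> k) = 0" if "k < n" for k
    using that by (auto simp: q_def poly_prod)
  show thesis
  proof (cases s)
    case (Suc s')
    define p where "p = monom 1 s' mod q"
    have "q \<noteq> 0"
      using deg_q n by auto
    then have "degree p < n"
      using degree_mod_less[of q "monom 1 s'"] deg_q n by (auto simp: p_def)
    moreover have "poly p (\<sigma> k) = \<sigma> k ^ s'" if "k < n" for k
    proof -
      have "monom 1 s' = monom 1 s' div q * q + p"
        by (simp add: p_def)
      then have "poly (monom 1 s') (\<sigma> k) = poly (monom 1 s' div q * q + p) (\<sigma> k)"
        by (rule arg_cong)
      then show ?thesis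
        using root[OF that] by (simp add: poly_monom)
    qed
    ultimately show thesis
      using that[of p] Suc by simp
  next
    case 0
    obtain q0 r where q: "q = pCons q0 r"
      by (cases q)
    have "q0 = poly q 0"
      by (simp add: q)
    \<comment> \<open>The value at 0 is the product of all \<open>- \<sigma> k\<close>.\<close>
    moreover have "poly q 0 \<noteq> 0"
      using nz[OF 0] by (simp add: q_def poly_prod)
    ultimately have q0: "q0 \<noteq> 0"
      by simp
    have "degree r < n"
      using deg_q n by (auto simp: q split: if_splits)
    then have "degree (Polynomial.smult (- 1 / q0) r) < n"
      by (metis degree_smult_le le_less_trans)
    moreover have "\<sigma> k * poly (Polynomial.smult (- 1 / q0) r) (\<sigma> k) = \<sigma> k ^ s" if "k < n" for k
      using root[OF that] q0 0 by (simp add: q field_simps)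
    ultimately show thesis
      by (rule that)
  qed
qed

text \<open>The coefficients of the interpolating polynomial \<open>w\<close> weight the blocks of
  the stack. These start at power 1, which accounts for the extra factor \<open>p $ k\<close> in
  front of \<open>poly w (p $ k)\<close>.\<close>

lemma modal_mat_in_row_space:
  assumes p: "p \<in> carrier_vec n" and n: "0 < n" and N: "n \<le> N"
    and nz: "s = 0 \<Longrightarrow> \<forall>k<n. p $ k \<noteq> 0"
  obtains W where "W \<in> carrier_mat (l * m) (N * (l * m))" "modal_mat l m p s = W * modal_stack l m p N"
proof -
  obtain w where deg: "degree w < n" and w: "\<And>k. k < n \<Longrightarrow> p $ k * poly w (p $ k) = (p $ k) ^ s"
    using power_interpolation[OF n, of s "\<lambda>k. p $ k"] nz by blast
  define W where "W = block_row (l * m) (l * m) N (\<lambda>t. Polynomial.coeff w t \<cdot>\<^sub>m 1\<^sub>m (l * m))"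
  have G: "modal_mat l m p t \<in> carrier_mat (l * m) (l * m * n)" for t
    by (simp add: modal_mat_eq[OF p n])
  have dim: "dim_vec p = n"
    using p by simp
  have "modal_mat l m p s = W * modal_stack l m p N"
  proof (rule eq_matI)
    fix i j
    assume "i < dim_row (W * modal_stack l m p N)" "j < dim_col (W * modal_stack l m p N)"
    then have i: "i < l * m" and j: "j < l * m * n"
      by (auto simp: W_def block_row_def modal_stack_def block_col_def dim)
    have "(W * modal_stack l m p N) $$ (i, j)
        = (\<Sum>t = 0..<N. ((Polynomial.coeff w t \<cdot>\<^sub>m 1\<^sub>m (l * m)) * modal_mat l m p (t + 1)) $$ (i, j))"
      unfolding W_def modal_stack_def dim
      by (rule index_block_row_mult_block_col) (use i j G in auto)
    also have "\<dots> = (\<Sum>t = 0..<N. Polynomial.coeff w t * modal_mat l m p (t + 1) $$ (i, j))"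
      using i j G by (intro sum.cong refl) (simp add: mult_smult_assoc_mat[OF one_carrier_mat G]
          left_mult_one_mat[OF G] smult_carrier_mat carrier_matD[OF G] del: index_mult_mat)
    also have "\<dots> = (if i = j div n then p $ (j mod n) * poly w (p $ (j mod n)) else 0)"
      using i j deg N
      by (simp add: modal_mat_eq[OF p n] poly_as_sum_below[of w N] sum_distrib_left algebra_simps)
    also have "\<dots> = modal_mat l m p s $$ (i, j)"
      using i j w n by (simp add: modal_mat_eq[OF p n])
    finally show "modal_mat l m p s $$ (i, j) = (W * modal_stack l m p N) $$ (i, j)" ..
  qed (auto simp: modal_mat_eq[OF p n] W_def block_row_def modal_stack_def block_col_def dim)
  moreover have "W \<in> carrier_mat (l * m) (N * (l * m))"
    unfolding W_def by (rule block_row_carrier)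
  ultimately show thesis
    using that by blast
qed

subsection \<open>Modal form of the impulse response\<close>

lemma mat_diag_pow: "mat_diag n f ^\<^sub>m k = mat_diag n (\<lambda>i. f i ^ k)" for f :: "nat \<Rightarrow> 'a::comm_ring_1"
  by (induction k) (auto simp: mat_diag_def[of n "\<lambda>_. 1"] intro!: eq_matI simp: mult.commute,
    simp_all add: mat_diag_def)

text \<open>Diagonalization gives \<open>A ^\<^sub>m t = P * D * Q\<close> with \<open>D\<close> the
  diagonal matrix of the powers. The argument \<open>t + 1\<close> cancels the truncating
  subtraction in \<open>impulse_response\<close>.\<close>

lemma impulse_response_modal:
  assumes A: "A \<in> carrier_mat n n" and B: "B \<in> carrier_mat n m" and C: "C \<in> carrier_mat l n"
    and P: "P \<in> carrier_mat n n" and Q: "Q \<in> carrier_mat n n"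
    and inv: "inverts_mat P Q" "inverts_mat Q P"
    and diag: "Q * A * P = mat_diag n (\<lambda>i. \<sigma> $ i)"
    and i: "i < l" and j: "j < m"
  shows "impulse_response A B C (t + 1) $$ (i, j)
    = (\<Sum>k = 0..<n. \<sigma> $ k ^ t * ((C * P) $$ (i, k) * (Q * B) $$ (k, j)))"
proof -
  let ?D = "mat_diag n (\<lambda>i. \<sigma> $ i ^ t)"
  have PQ: "P * Q = 1\<^sub>m n" "Q * P = 1\<^sub>m n"
    using inv P Q by (auto simp: inverts_mat_def)
  have "similar_mat_wit (mat_diag n (\<lambda>i. \<sigma> $ i)) A Q P"
    by (rule similar_mat_witI[of _ _ n]) (use PQ A P Q diag in auto)
  then have pow: "A ^\<^sub>m t = P * ?D * Q"
    using similar_mat_wit_pow_id[OF similar_mat_wit_sym] mat_diag_pow by metis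
  have CP: "C * P \<in> carrier_mat l n" and QB: "Q * B \<in> carrier_mat n m"
    using C P Q B by auto
  have D: "?D \<in> carrier_mat n n"
    by simp
  have CPD: "C * P * ?D \<in> carrier_mat l n"
    using CP by simp
  have PD: "P * ?D \<in> carrier_mat n n"
    using P by simp
  have "impulse_response A B C (t + 1) = C * (P * ?D * Q) * B"
    by (simp add: impulse_response_def pow)
  also have "\<dots> = C * (P * ?D) * Q * B"
    by (simp only: assoc_mult_mat[OF C PD Q])
  also have "\<dots> = C * P * ?D * Q * B"
    by (simp only: assoc_mult_mat[OF C P D])
  also have "\<dots> = C * P * ?D * (Q * B)"
    by (rule assoc_mult_mat[OF CPD Q B])
  finally have "impulse_response A B C (t + 1) = C * P * ?D * (Q * B)" .
  then show ?thesis
    using i j by (simp only: index_mult_mat_sum[OF CPD QB])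
      (simp add: mat_diag_mult_right[OF CP] algebra_simps del: index_mult_mat)
qed

text \<open>Row \<open>q\<close> of \<open>X\<close> encodes mode \<open>q mod n\<close> and stacked
  row \<open>a = q div n\<close>, that is, input \<open>a div l\<close> and output
  \<open>a mod l\<close>. Since \<open>X\<close> does not involve \<open>t\<close>, one
  \<open>X\<close> serves all times.\<close>

lemma modal_mat_mult_coefficients:
  assumes p: "p \<in> carrier_vec n" and n: "0 < n" and l: "0 < l"
    and M: "M \<in> carrier_mat l m"
    and ent: "\<And>i j. i < l \<Longrightarrow> j < m \<Longrightarrow> M $$ (i, j) = (\<Sum>k = 0..<n. p $ k ^ t * h i k j)"
    and X: "X = mat (l * m * n) m
      (\<lambda>(q, j). if q div n div l = j then h (q div n mod l) (q mod n) j else 0)"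
  shows "modal_mat l m p t * X = blkdiag_cols M"
proof (rule eq_matI)
  fix i j assume "i < dim_row (blkdiag_cols M)" "j < dim_col (blkdiag_cols M)"
  then have i: "i < l * m" and j: "j < m"
    by (auto simp: blkdiag_cols_eq[OF M l])
  have c: "modal_mat l m p t \<in> carrier_mat (l * m) (l * m * n)" "X \<in> carrier_mat (l * m * n) m"
    by (simp_all add: modal_mat_eq[OF p n] X)
  \<comment> \<open>Written in block number and offset; only the block \<open>a = i\<close>
    contributes.\<close>
  define f where "f a k = (if i = a then p $ k ^ t * (if a div l = j then h (a mod l) k j else 0) else 0)"
    for a k
  have "(modal_mat l m p t * X) $$ (i, j) = (\<Sum>q = 0..<l * m * n. f (q div n) (q mod n))"
    using i j by (simp only: index_mult_mat_sum[OF c i j])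
      (intro sum.cong, auto simp: modal_mat_eq[OF p n] X f_def)
  also have "\<dots> = (\<Sum>a = 0..<l * m. \<Sum>k = 0..<n. f a k)"
    by (rule sum_mult_div_mod)
  also have "\<dots> = (\<Sum>a = 0..<l * m. if a = i then \<Sum>k = 0..<n. f i k else 0)"
    by (intro sum.cong refl) (auto simp: f_def)
  also have "\<dots> = (\<Sum>k = 0..<n. f i k)"
    using i by simp
  also have "\<dots> = blkdiag_cols M $$ (i, j)"
    using i j l by (simp add: f_def blkdiag_cols_eq[OF M l] ent)
  finally show "(modal_mat l m p t * X) $$ (i, j) = blkdiag_cols M $$ (i, j)" .
qed (auto simp: modal_mat_eq[OF p n] X blkdiag_cols_eq[OF M l])

section \<open>Reconstruction of the impulse response\<close>

text \<open>The case \<open>T = 1\<close> asks for power 0 of the modes. A zero mode can contribute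
  to the first sample but to none of the later ones in the stack, so there the modes are assumed
  nonzero.\<close>

theorem mainTheorem4:
  fixes A B C \<T> \<T>inv :: "real mat" and \<sigma> :: "real vec" and l m n T0 T :: nat
  assumes dims: "0 < l" "0 < m" "0 < n"
    and A: "A \<in> carrier_mat n n"
    and B: "B \<in> carrier_mat n m"
    and C: "C \<in> carrier_mat l n"
    and ctrb: "controllable n m A B"
    and obsv: "observable n m A B C"
    and T_carrier: "\<T> \<in> carrier_mat n n" "\<T>inv \<in> carrier_mat n n"
    and T_inv: "inverts_mat \<T> \<T>inv" "inverts_mat \<T>inv \<T>"
    and modes: "\<sigma> \<in> carrier_vec n" "\<T>inv * A * \<T> = mat_diag n (\<lambda>i. \<sigma> $ i)"
    and T0: "n \<le> T0"
    and T: "1 \<le> T" "T = 1 \<Longrightarrow> (\<forall>i < n. \<sigma> $ i \<noteq> 0)"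
  shows "impulse_response A B C T =
      block_row l l m (\<lambda>_. 1\<^sub>m l) * modal_mat l m \<sigma> (T - 1)
        * pseudoinverse (modal_stack l m \<sigma> T0)
        * sample_stack l m (impulse_response A B C) T0"
proof -
  define M where "M = impulse_response A B C"
  define H where "H = modal_stack l m \<sigma> T0"
  define X where "X = mat (l * m * n) m (\<lambda>(q, j). if q div n div l = j
    then (C * \<T>) $$ (q div n mod l, q mod n) * (\<T>inv * B) $$ (q mod n, j) else 0)"
  define R where "R = block_row l l m (\<lambda>_. 1\<^sub>m l :: real mat)"
  have M: "M t \<in> carrier_mat l m" for t
    unfolding M_def impulse_response_def
    by (rule mult_carrier_mat[OF mult_carrier_mat[OF C pow_carrier_mat[OF A]] B])
  have modal_X: "modal_mat l m \<sigma> t * X = blkdiag_cols (M (t + 1))" for t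
    unfolding M_def
    by (rule modal_mat_mult_coefficients[OF modes(1) dims(3,1) M[unfolded M_def]
          impulse_response_modal[OF A B C T_carrier T_inv modes(2)] X_def])
  have modal_c: "modal_mat l m \<sigma> t \<in> carrier_mat (l * m) (l * m * n)" for t
    by (simp add: modal_mat_eq[OF modes(1) dims(3)])
  have Xc: "X \<in> carrier_mat (l * m * n) m"
    by (simp add: X_def)
  have dim: "dim_vec \<sigma> = n"
    using modes(1) by simp
  \<comment> \<open>Block \<open>k\<close> holds the sample at time \<open>k + 2\<close>, which
    belongs to power \<open>k + 1\<close>, the power in block \<open>k\<close> of
    \<open>H\<close>.\<close>
  have S: "sample_stack l m M T0 = H * X"
    unfolding H_def modal_stack_def sample_stack_def dim
    by (subst block_col_mult[OF modal_c Xc]) (simp add: modal_X)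
  have Hc: "H \<in> carrier_mat (T0 * (l * m)) (l * m * n)"
    unfolding H_def by (rule modal_stack_carrier[OF modes(1)])
  define Y where "Y = pseudoinverse H"
  have Y: "Y \<in> carrier_mat (l * m * n) (T0 * (l * m))" and HYH: "H * Y * H = H"
    using is_pseudoinverse_pseudoinverse[of H] Hc by (auto simp: is_pseudoinverse_def Y_def)
  have "T - 1 = 0 \<Longrightarrow> \<forall>k<n. \<sigma> $ k \<noteq> 0"
    using T by force
  then obtain W where W: "W \<in> carrier_mat (l * m) (T0 * (l * m))"
    and WH: "modal_mat l m \<sigma> (T - 1) = W * H"
    using modal_mat_in_row_space[OF modes(1) dims(3) T0] unfolding H_def by metis
  have Rc: "R \<in> carrier_mat l (l * m)"
    using block_row_carrier[of l l m] by (simp add: R_def mult.commute)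
  have HY: "H * Y \<in> carrier_mat (T0 * (l * m)) (T0 * (l * m))" and WHc: "W * H \<in> carrier_mat (l * m) (l * m * n)"
    and HX: "H * X \<in> carrier_mat (T0 * (l * m)) m"
    using Hc Y W Xc by (metis mult_carrier_mat)+
  have WHY: "W * (H * Y) \<in> carrier_mat (l * m) (T0 * (l * m))"
    using W HY by (rule mult_carrier_mat)
  \<comment> \<open>Reassociation exposes \<open>H * Y * H\<close>, which the first Penrose equation
    collapses to \<open>H\<close>.\<close>
  have "R * (W * H) * Y * (H * X) = R * (W * (H * Y * H) * X)"
  proof -
    have "R * (W * H) * Y * (H * X) = R * (W * H * Y) * (H * X)"
      by (simp add: assoc_mult_mat[OF Rc WHc Y])
    also have "\<dots> = R * (W * (H * Y)) * (H * X)"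
      by (simp add: assoc_mult_mat[OF W Hc Y])
    also have "\<dots> = R * (W * (H * Y) * (H * X))"
      by (rule assoc_mult_mat[OF Rc WHY HX])
    also have "W * (H * Y) * (H * X) = W * (H * Y) * H * X"
      by (rule assoc_mult_mat[OF WHY Hc Xc, symmetric])
    also have "W * (H * Y) * H = W * (H * Y * H)"
      using assoc_mult_mat[OF W HY Hc] .
    finally show ?thesis .
  qed
  also have "\<dots> = R * blkdiag_cols (M T)"
    using modal_X[of "T - 1"] T(1) by (simp add: HYH WH[symmetric])
  also have "\<dots> = M T"
    unfolding R_def by (rule sum_blkdiag_cols[OF M dims(1)])
  finally show ?thesis
    using S WH by (simp add: M_def R_def Y_def H_def)
qed

end
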